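(* Let $(\mathfrak{g}, [\cdot,\cdot]_{\mathfrak{g}}, \alpha_{\mathfrak{g}}, \langle\cdot,\cdot\rangle)$ be a pseudo-Riemannian (regular) Hom-Lie algebra. Then the set $\mathfrak{K}$ of Killing vectors of $\mathfrak{g}$ is a totally geodesic Hom-Lie subalgebra of $\mathfrak{g}$.
   Context: A Hom-Lie algebra is a triple $(\mathfrak{g},[\cdot,\cdot]_{\mathfrak{g}},\alpha_{\mathfrak{g}})$ where $\mathfrak{g}$ is a (here finite-dimensional real) vector space, $[\cdot,\cdot]_{\mathfrak{g}}:\mathfrak{g}\times\mathfrak{g}\to\mathfrak{g}$ is a skew-symmetric bilinear map, and $\alpha_{\mathfrak{g}}:\mathfrak{g}\to\mathfrak{g}$ is a linear map with $\alpha_{\mathfrak{g}}([x,y]_{\mathfrak{g}})=[\alpha_{\mathfrak{g}}(x),\alpha_{\mathfrak{g}}(y)]_{\mathfrak{g}}$ for all $x,y$, such that the Hom-Jacobi identity $[\alpha_{\mathfrak{g}}(x),[y,z]_{\mathfrak{g}}]_{\mathfrak{g}}+[\alpha_{\mathfrak{g}}(y),[z,x]_{\mathfrak{g}}]_{\mathfrak{g}}+[\alpha_{\mathfrak{g}}(z),[x,y]_{\mathfrak{g}}]_{\mathfrak{g}}=0$ holds for all $x,y,z\in\mathfrak{g}$. It is regular if $\alpha_{\mathfrak{g}}$ is invertible; all Hom-Lie algebras are assumed regular. A Hom-Lie subalgebra is a linear subspace $\mathfrak{h}\subseteq\mathfrak{g}$ with $\alpha_{\mathfrak{g}}(\mathfrak{h})\subseteq\mathfrak{h}$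 and $[x,y]_{\mathfrak{g}}\in\mathfrak{h}$ for all $x,y\in\mathfrak{h}$. A pseudo-Riemannian Hom-Lie algebra is such a triple together with a non-degenerate symmetric bilinear form $\langle\cdot,\cdot\rangle:\mathfrak{g}\times\mathfrak{g}\to\mathbb{R}$ with $\langle\alpha_{\mathfrak{g}}(x),\alpha_{\mathfrak{g}}(y)\rangle=\langle x,y\rangle$ for all $x,y$. The Hom-Levi-Civita connection is the unique bilinear map $\nabla:\mathfrak{g}\times\mathfrak{g}\to\mathfrak{g}$, $(x,y)\mapsto\nabla_x y$, given by the Koszul formula $$2\langle\nabla_x y,\alpha_{\mathfrak{g}}(z)\rangle=\langle[x,y]_{\mathfrak{g}},\alpha_{\mathfrak{g}}(z)\rangle+\langle[z,y]_{\mathfrak{g}},\alpha_{\mathfrak{g}}(x)\rangle+\langle[z,x]_{\mathfrak{g}},\alpha_{\mathfrak{g}}(y)\rangle$$ for all $x,y,z\in\mathfrak{g}$. It satisfies $[x,y]_{\mathfrak{g}}=\nabla_x y-\nabla_y x$, $\langle\nabla_x y,\alpha_{\mathfrak{g}}(z)\rangle=-\langle\alpha_{\mathfrak{g}}(y),\nabla_x z\rangle$ and $\alpha_{\mathfrak{g}}(\nabla_x y)=\nabla_{\alpha_{\mathfrak{g}}(x)}\alpha_{\mathfrak{g}}(y)$. A Hom-Lie subalgebra $\mathfrak{h}$ of $\mathfrak{g}$ is totally geodesic if $\nabla_x y\in\mathfrak{h}$ for all $x,y\in\mathfrak{h}$. A vector $v\in\mathfrak{g}$ is Killing if $\langle\nabla_x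 v,\alpha_{\mathfrak{g}}(y)\rangle=-\langle\nabla_y v,\alpha_{\mathfrak{g}}(x)\rangle$ for all $x,y\in\mathfrak{g}$. *)

theory Defs
  imports "HOL-Analysis.Analysis"
begin

text \<open>The underlying vector space is the whole type \<^typ>\<open>'a\<close>. The class
  \<^class>\<open>real_vector\<close> is used rather than a normed or Euclidean class so that no norm or inner
  product is in play other than the form supplied explicitly.\<close>

locale hom_lie_algebra =
  fixes bracket :: "'a::real_vector \<Rightarrow> 'a \<Rightarrow> 'a"
    and \<alpha> :: "'a \<Rightarrow> 'a"
  assumes finite_dim: "\<exists>B::'a set. finite B \<and> span B = UNIV"
    and bracket_bilinear: "bilinear bracket"
    and bracket_skew: "\<And>x y. bracket x y = - bracket y x"
    and alpha_linear: "linear \<alpha>"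
    and alpha_bracket: "\<And>x y. \<alpha> (bracket x y) = bracket (\<alpha> x) (\<alpha> y)"
    and hom_jacobi: "\<And>x y z. bracket (\<alpha> x) (bracket y z) + bracket (\<alpha> y) (bracket z x)
                        + bracket (\<alpha> z) (bracket x y) = 0"

locale regular_hom_lie_algebra = hom_lie_algebra +
  assumes alpha_bij: "bij \<alpha>"

locale pseudo_riemannian_hom_lie_algebra = regular_hom_lie_algebra bracket \<alpha>
  for bracket :: "'a::real_vector \<Rightarrow> 'a \<Rightarrow> 'a" and \<alpha> +
  fixes form :: "'a \<Rightarrow> 'a \<Rightarrow> real"
  assumes form_bilinear: "bilinear form"
    and form_sym: "\<And>x y. form x y = form y x"
    and form_nondegenerate: "\<And>x. (\<And>y. form x y = 0) \<Longrightarrow> x = 0"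
    and form_alpha: "\<And>x y. form (\<alpha> x) (\<alpha> y) = form x y"

definition hom_lie_subalgebra ::
  "('a::real_vector \<Rightarrow> 'a \<Rightarrow> 'a) \<Rightarrow> ('a \<Rightarrow> 'a) \<Rightarrow> 'a set \<Rightarrow> bool" where
  "hom_lie_subalgebra bracket \<alpha> H \<longleftrightarrow>
     subspace H \<and> \<alpha> ` H \<subseteq> H \<and> (\<forall>x\<in>H. \<forall>y\<in>H. bracket x y \<in> H)"

definition koszul ::
  "('a::real_vector \<Rightarrow> 'a \<Rightarrow> 'a) \<Rightarrow> ('a \<Rightarrow> 'a) \<Rightarrow> ('a \<Rightarrow> 'a \<Rightarrow> real) \<Rightarrow> ('a \<Rightarrow> 'a \<Rightarrow> 'a) \<Rightarrow> bool" where
  "koszul bracket \<alpha> form nabla \<longleftrightarrow>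
     (\<forall>x y z. 2 * form (nabla x y) (\<alpha> z) =
        form (bracket x y) (\<alpha> z) + form (bracket z y) (\<alpha> x) + form (bracket z x) (\<alpha> y))"

text \<open>The first argument of the connection is the direction of differentiation. The definite
  description is justified by \<open>hom_levi_civita_ex1\<close> below.\<close>

definition hom_levi_civita ::
  "('a::real_vector \<Rightarrow> 'a \<Rightarrow> 'a) \<Rightarrow> ('a \<Rightarrow> 'a) \<Rightarrow> ('a \<Rightarrow> 'a \<Rightarrow> real) \<Rightarrow> 'a \<Rightarrow> 'a \<Rightarrow> 'a" where
  "hom_levi_civita bracket \<alpha> form = (THE nabla. bilinear nabla \<and> koszul bracket \<alpha> form nabla)"

definition totally_geodesic ::
  "('a::real_vector \<Rightarrow> 'a \<Rightarrow> 'a) \<Rightarrow> ('a \<Rightarrow> 'a) \<Rightarrow> ('a \<Rightarrow> 'a \<Rightarrow> real) \<Rightarrow> 'a set \<Rightarrow> bool" where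
  "totally_geodesic bracket \<alpha> form H \<longleftrightarrow>
     (\<forall>x\<in>H. \<forall>y\<in>H. hom_levi_civita bracket \<alpha> form x y \<in> H)"

definition killing ::
  "('a::real_vector \<Rightarrow> 'a \<Rightarrow> 'a) \<Rightarrow> ('a \<Rightarrow> 'a) \<Rightarrow> ('a \<Rightarrow> 'a \<Rightarrow> real) \<Rightarrow> 'a \<Rightarrow> bool" where
  "killing bracket \<alpha> form v \<longleftrightarrow>
     (\<forall>x y. form (hom_levi_civita bracket \<alpha> form x v) (\<alpha> y) =
          - form (hom_levi_civita bracket \<alpha> form y v) (\<alpha> x))"

context pseudo_riemannian_hom_lie_algebra
begin

lemma form_eqI:
  assumes "\<And>z. form u (\<alpha> z) = form v (\<alpha> z)"
  shows "u = v"
proof -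
  have "form (u - v) y = 0" for y
  proof -
    obtain z where "y = \<alpha> z" using alpha_bij by (metis bij_pointE)
    then show ?thesis using assms by (simp add: bilinear_lsub[OF form_bilinear])
  qed
  then show ?thesis using form_nondegenerate[of "u - v"] by simp
qed

lemma form_represents:
  assumes "linear f"
  shows "\<exists>u. \<forall>z. form u (\<alpha> z) = f z"
proof -
  obtain S :: "'a set" where S: "finite S" "span S = UNIV" using finite_dim by blast
  obtain B where B: "B \<subseteq> S" "independent B" "S \<subseteq> span B"
    using maximal_independent_subset[of S] by blast
  have sB: "span B = UNIV"
    using span_mono[OF B(3)] S(2) unfolding span_span by blast
  have fB: "finite B" using B S finite_subset by blast
  interpret fd: finite_dimensional_vector_space scaleR B
    using B(2) sB fB unfolding dependent_raw_def span_raw_def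
    by unfold_locales
  define p where "p u = (\<Sum>b\<in>B. form u (\<alpha> b) *\<^sub>R b)" for u
  have "linear p"
    by (rule linearI) (simp_all add: p_def bilinear_ladd[OF form_bilinear]
        bilinear_lmul[OF form_bilinear] scaleR_add_left sum.distrib scaleR_sum_right)
  have lin: "linear (\<lambda>z. form u (\<alpha> z))" for u
    using form_bilinear linear_compose[OF alpha_linear, of "form u"]
    by (auto simp: bilinear_def o_def)
  have coeffs: "g = h" if "linear g" "linear h" "(\<Sum>b\<in>B. g b *\<^sub>R b) = (\<Sum>b\<in>B. h b *\<^sub>R b)"
    for g h :: "'a \<Rightarrow> real"
  proof -
    have "(\<Sum>b\<in>B. (g b - h b) *\<^sub>R b) = 0"
      using that(3) by (simp add: scaleR_diff_left sum_subtractf)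
    then have "\<forall>b\<in>B. g b = h b"
      using B(2) fB independentD[of B B "\<lambda>b. g b - h b"] by auto
    then have "g z = h z" for z
      using linear_eq_on_span[OF that(1,2), of B z] sB by auto
    then show ?thesis by auto
  qed
  have "inj p"
  proof (rule injI)
    fix u v assume "p u = p v"
    then show "u = v" using coeffs[OF lin lin, of u v] form_eqI[of u v] unfolding p_def by metis
  qed
  then have "surj p"
    using fd.linear_inj_imp_surj \<open>linear p\<close> unfolding linear_def by blast
  then obtain u where "p u = (\<Sum>b\<in>B. f b *\<^sub>R b)" by (metis surjD)
  then show ?thesis using coeffs[OF lin assms, of u] unfolding p_def by metis
qed

lemma hom_levi_civita_ex1: "\<exists>!nabla. bilinear nabla \<and> koszul bracket \<alpha> form nabla"
proof -
  define k where "k x y z = (form (bracket x y) (\<alpha> z) + form (bracket z y) (\<alpha> x)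
     + form (bracket z x) (\<alpha> y)) / 2" for x y z
  note bil = bilinear_ladd[OF form_bilinear] bilinear_radd[OF form_bilinear]
    bilinear_lmul[OF form_bilinear] bilinear_rmul[OF form_bilinear]
    bilinear_ladd[OF bracket_bilinear] bilinear_radd[OF bracket_bilinear]
    bilinear_lmul[OF bracket_bilinear] bilinear_rmul[OF bracket_bilinear]
    linear_add[OF alpha_linear] linear_scale[OF alpha_linear]
  have "linear (k x y)" for x y
    by (rule linearI) (simp_all add: k_def bil field_simps)
  then have ex: "\<exists>u. \<forall>z. form u (\<alpha> z) = k x y z" for x y
    by (rule form_represents)
  define N where "N x y = (SOME u. \<forall>z. form u (\<alpha> z) = k x y z)" for x y
  have N: "form (N x y) (\<alpha> z) = k x y z" for x y z
    using someI_ex[OF ex[of x y]] unfolding N_def by blast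
  have k1: "k (x + x') y z = k x y z + k x' y z" "k (c *\<^sub>R x) y z = c * k x y z"
    "k x (y + y') z = k x y z + k x y' z" "k x (c *\<^sub>R y) z = c * k x y z" for x x' y y' z c
    by (simp_all add: k_def bil field_simps)
  have "N x (y + y') = N x y + N x y'" "N x (c *\<^sub>R y) = c *\<^sub>R N x y"
    "N (x + x') y = N x y + N x' y" "N (c *\<^sub>R x) y = c *\<^sub>R N x y" for x x' y y' c
    by (rule form_eqI; simp only: N k1 bil real_scaleR_def)+
  then have "linear (N x)" "linear (\<lambda>x. N x y)" for x y
    by (auto intro: linearI)
  then have "bilinear N" by (simp add: bilinear_def)
  moreover have "koszul bracket \<alpha> form N" by (simp add: koszul_def N k_def)
  moreover have "M = N" if "koszul bracket \<alpha> form M" for M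
  proof (intro ext form_eqI)
    fix x y z
    show "form (M x y) (\<alpha> z) = form (N x y) (\<alpha> z)"
      using that[unfolded koszul_def, rule_format, of x y z] by (simp add: N k_def)
  qed
  ultimately show ?thesis by blast
qed

end

end

theory Submission imports Defs begin

text \<open>By the Koszul formula, \<open>v\<close> is Killing iff bracketing with \<open>v\<close> is skew-adjoint in the
  twisted sense \<open>\<langle>[v,x],\<alpha> y\<rangle> = - \<langle>[v,y],\<alpha> x\<rangle>\<close>. Invariance under \<open>\<alpha>\<close> is then immediate, and the
  Hom-Jacobi identity, together with bijectivity of \<open>\<alpha>\<close>, gives closure under the bracket as for
  commutators of skew-adjoint maps. For Killing \<open>v\<close> and \<open>w\<close>, two of the three Koszul
  terms cancel and \<open>\<nabla>\<^sub>v w = [v,w]/2\<close>, which is Killing again.\<close>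

context pseudo_riemannian_hom_lie_algebra
begin

lemma koszul_hom_levi_civita:
  "2 * form (hom_levi_civita bracket \<alpha> form x y) (\<alpha> z) =
    form (bracket x y) (\<alpha> z) + form (bracket z y) (\<alpha> x) + form (bracket z x) (\<alpha> y)"
  using theI'[OF hom_levi_civita_ex1] unfolding hom_levi_civita_def koszul_def by blast

lemma form_bracket_swap_left: "form (bracket x y) z = - form (bracket y x) z"
  by (subst bracket_skew) (simp add: bilinear_lneg[OF form_bilinear])

text \<open>Adding the Koszul formulas for the two sides of the Killing condition cancels the terms
  in \<open>bracket x y\<close> and doubles the others, so the connection disappears.\<close>

lemma killing_iff_bracket_skew_adjoint:
  "killing bracket \<alpha> form v \<longleftrightarrow>
    (\<forall>x y. form (bracket v x) (\<alpha> y) = - form (bracket v y) (\<alpha> x))"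
proof -
  have sum: "form (hom_levi_civita bracket \<alpha> form x v) (\<alpha> y)
        + form (hom_levi_civita bracket \<alpha> form y v) (\<alpha> x)
      = - (form (bracket v x) (\<alpha> y) + form (bracket v y) (\<alpha> x))" for x y
    using koszul_hom_levi_civita[of x v y] koszul_hom_levi_civita[of y v x]
      form_bracket_swap_left[of x v] form_bracket_swap_left[of y v]
      form_bracket_swap_left[of x y] by simp
  show ?thesis
    unfolding killing_def by (simp only: eq_neg_iff_add_eq_0 sum neg_equal_0_iff_equal)
qed

text \<open>For fixed \<open>x\<close> and \<open>y\<close> the skewness condition is linear in
  \<open>v\<close>, so the set is an intersection of kernels.\<close>

lemma subspace_killing: "subspace {v. killing bracket \<alpha> form v}"
proof -
  have "linear (\<lambda>v. form (bracket v x) (\<alpha> y) + form (bracket v y) (\<alpha> x))" for x y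
    by (rule linearI)
      (simp_all add: bilinear_ladd[OF bracket_bilinear] bilinear_lmul[OF bracket_bilinear]
        bilinear_ladd[OF form_bilinear] bilinear_lmul[OF form_bilinear] distrib_left)
  then have "subspace {v. form (bracket v x) (\<alpha> y) + form (bracket v y) (\<alpha> x) = 0}" for x y
    by (rule linear_subspace_kernel)
  then have "subspace (\<Inter>x. \<Inter>y. {v. form (bracket v x) (\<alpha> y) + form (bracket v y) (\<alpha> x) = 0})"
    by (auto intro!: subspace_Inter)
  moreover have "{v. killing bracket \<alpha> form v}
      = (\<Inter>x. \<Inter>y. {v. form (bracket v x) (\<alpha> y) + form (bracket v y) (\<alpha> x) = 0})"
    by (auto simp only: killing_iff_bracket_skew_adjoint eq_neg_iff_add_eq_0)
  ultimately show ?thesis by simp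
qed

text \<open>By surjectivity the test vectors may be taken in the form \<open>\<alpha> x'\<close>,
  \<open>\<alpha> y'\<close>; one \<alpha> then comes out of the bracket and is absorbed by the
  isometry.\<close>

lemma killing_alpha:
  assumes "killing bracket \<alpha> form v"
  shows "killing bracket \<alpha> form (\<alpha> v)"
  unfolding killing_iff_bracket_skew_adjoint
proof (intro allI)
  fix x y
  obtain x' y' where "x = \<alpha> x'" "y = \<alpha> y'"
    using alpha_bij by (metis bij_pointE)
  then show "form (bracket (\<alpha> v) x) (\<alpha> y) = - form (bracket (\<alpha> v) y) (\<alpha> x)"
    using assms[unfolded killing_iff_bracket_skew_adjoint]
    by (metis alpha_bracket form_alpha)
qed

text \<open>Hom-Jacobi read as a twisted commutator formula for the adjoint action.\<close>

lemma bracket_bracket_alpha: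
  "bracket (bracket v w) (\<alpha> x) = bracket (\<alpha> v) (bracket w x) - bracket (\<alpha> w) (bracket v x)"
proof -
  have "bracket (\<alpha> w) (bracket x v) = - bracket (\<alpha> w) (bracket v x)"
    by (subst bracket_skew[of x v]) (simp add: bilinear_rneg[OF bracket_bilinear])
  then have "bracket (\<alpha> x) (bracket v w)
      + (bracket (\<alpha> v) (bracket w x) - bracket (\<alpha> w) (bracket v x)) = 0"
    using hom_jacobi[of x v w] by (simp add: algebra_simps)
  then show ?thesis
    unfolding bracket_skew[of "bracket v w"] by (rule minus_unique)
qed

lemma killing_bracket:
  assumes v: "killing bracket \<alpha> form v" and w: "killing bracket \<alpha> form w"
  shows "killing bracket \<alpha> form (bracket v w)"
  unfolding killing_iff_bracket_skew_adjoint
proof (intro allI)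
  \<comment> \<open>Skewness is applied to \<open>\<alpha> u\<close>, which is again Killing; the
    isometry then strips one \<alpha> from both sides.\<close>
  have move: "form (bracket (\<alpha> u) a) (\<alpha> (\<alpha> b)) = - form (bracket u b) a"
    if "killing bracket \<alpha> form u" for u a b
    using killing_alpha[OF that, unfolded killing_iff_bracket_skew_adjoint]
    by (metis alpha_bracket form_alpha)
  \<comment> \<open>The right-hand side changes sign when \<open>a\<close> and \<open>b\<close> are
    exchanged, by symmetry of the form; this is the skewness sought.\<close>
  have eq: "form (bracket (bracket v w) (\<alpha> a)) (\<alpha> (\<alpha> b))
      = form (bracket w b) (bracket v a) - form (bracket v b) (bracket w a)" for a b
    by (simp add: bracket_bracket_alpha bilinear_lsub[OF form_bilinear] move v w)
  fix x y
  obtain a b where "x = \<alpha> a" "y = \<alpha> b"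
    using alpha_bij by (metis bij_pointE)
  then show "form (bracket (bracket v w) x) (\<alpha> y) = - form (bracket (bracket v w) y) (\<alpha> x)"
    by (simp add: eq form_sym[of "bracket w _"])
qed

lemma hom_levi_civita_killing:
  assumes v: "killing bracket \<alpha> form v" and w: "killing bracket \<alpha> form w"
  shows "hom_levi_civita bracket \<alpha> form v w = (1/2) *\<^sub>R bracket v w"
proof (rule form_eqI)
  fix z
  \<comment> \<open>Skewness for \<open>w\<close> makes the second Koszul term minus the first;
    skewness for \<open>v\<close> makes the third equal to the first. A single copy remains.\<close>
  have "form (bracket z w) (\<alpha> v) = - form (bracket v w) (\<alpha> z)"
    using w[unfolded killing_iff_bracket_skew_adjoint, rule_format, of z v]
      form_bracket_swap_left[of z w] form_bracket_swap_left[of v w] by simp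
  moreover have "form (bracket z v) (\<alpha> w) = form (bracket v w) (\<alpha> z)"
    using v[unfolded killing_iff_bracket_skew_adjoint, rule_format, of z w]
      form_bracket_swap_left[of z v] by simp
  ultimately show "form (hom_levi_civita bracket \<alpha> form v w) (\<alpha> z)
      = form ((1/2) *\<^sub>R bracket v w) (\<alpha> z)"
    using koszul_hom_levi_civita[of v w z] by (simp add: bilinear_lmul[OF form_bilinear])
qed

end

theorem proposition17:
  fixes bracket :: "'a::real_vector \<Rightarrow> 'a \<Rightarrow> 'a"
    and \<alpha> :: "'a \<Rightarrow> 'a"
    and form :: "'a \<Rightarrow> 'a \<Rightarrow> real"
  assumes "pseudo_riemannian_hom_lie_algebra bracket \<alpha> form"
  shows "hom_lie_subalgebra bracket \<alpha> {v. killing bracket \<alpha> form v}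
       \<and> totally_geodesic bracket \<alpha> form {v. killing bracket \<alpha> form v}"
proof -
  interpret pseudo_riemannian_hom_lie_algebra bracket \<alpha> form by (fact assms)
  \<comment> \<open>On Killing vectors the connection is half the bracket, so bracket closure and
    scaling suffice.\<close>
  have "killing bracket \<alpha> form (hom_levi_civita bracket \<alpha> form v w)"
    if "killing bracket \<alpha> form v" "killing bracket \<alpha> form w" for v w
    using subspace_scale[OF subspace_killing, of "bracket v w" "1/2"] killing_bracket[OF that]
    by (simp add: hom_levi_civita_killing[OF that])
  then show ?thesis
    using subspace_killing killing_alpha killing_bracket
    by (auto simp: hom_lie_subalgebra_def totally_geodesic_def)
qed

end
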